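(* Let $(X,\mu)$ be a measure space and $\mathbb{R}_+=(0,\infty)$. Let $K:X\times X\times\mathbb{R}_+\to[0,+\infty)$ be measurable and suppose there exist $\lambda_-,\lambda_+$ with $\lambda_+\ge\lambda_->0$ such that $$e^{-t\lambda_+}\le\int_X K(x,y;t)\,d\mu(y)\le e^{-t\lambda_-}\quad\text{for a.e. }x\in X,\ \text{a.e. }t\in\mathbb{R}_+ .$$ Let $g:X\times\mathbb{R}_+\to[0,+\infty)$ be measurable with $g\in L^\infty(X\times\mathbb{R}_+)$, put $\beta=\|g\|_{L^\infty(X\times\mathbb{R}_+)}$, and suppose there exists $T_0>0$ such that $\inf_{(x,t)\in X\times(0,T_0)}g(x,t)=\beta_0>0$. Let $h:X\times\mathbb{R}_+\to[0,+\infty)$ be measurable with $$\alpha=\inf_{(x,t)\in X\times\mathbb{R}_+}h(x,t)>0,\qquad \gamma=\|h\|_{L^\infty(X\times\mathbb{R}_+)}<\infty .$$ Let $G:[0,+\infty)\to[0,+\infty)$ be continuous, strictly increasing and concave, with $G(0)=0$. Assume that there exists $\eta>0$ such that $\gamma\,G(\eta)=(\eta-\beta)\lambda_-$. Then the integral equation $$u(x,t)=g(x,t)+\int_0^t\int_X K(x,y;t-s)\,h(y,s)\,G(u(y,s))\,d\mu(y)\,ds$$ cannot have two distinct non-negative solutions in $L^\infty(X\times\mathbb{R}_+)$.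
   Context: $\mathbb{R}_+=(0,\infty)$ carries Lebesgue measure, and $X\times\mathbb{R}_+$ and $X\times X\times\mathbb{R}_+$ carry the corresponding product measures; "a.e." refers to these measures. The integral equation is understood to hold for a.e. $x\in X$ and a.e. $t\in\mathbb{R}_+$, and solutions are identified when they are equal almost everywhere. *)

theory Defs
  imports "HOL-Probability.Essential_Supremum"
begin

section \<open>The product measure of two arbitrary measure spaces\<close>

text \<open>
  The measure space \<open>X\<close> is not assumed to be \<open>\<sigma>\<close>-finite. The library's \<open>\<Otimes>\<^sub>M\<close> computes the
  measure of a set as one fixed iterated integral, which without \<open>\<sigma>\<close>-finiteness need not be
  symmetric in the two factors: if \<open>X = (0, \<infinity>)\<close> carries counting measure and the second factor
  Lebesgue measure, the diagonal is null although each of its sections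
  \<open>{x. (x, t) \<in> diagonal}\<close> has measure \<open>1\<close>. We therefore use the
  textbook product measure, that is, the Caratheodory extension of
  \<open>A \<times> B \<mapsto> \<mu>(A) \<nu>(B)\<close> (with \<open>0 * \<infinity> = 0\<close>), restricted to the product \<open>\<sigma>\<close>-algebra. On
  \<open>\<sigma>\<close>-finite spaces it is the library's product; see \<open>product_measure_eq_pair_measure\<close> below.
\<close>

definition product_outer :: "'a measure \<Rightarrow> 'b measure \<Rightarrow> ('a \<times> 'b) set \<Rightarrow> ennreal" where
  "product_outer M N E =
     Inf {(\<Sum>i. emeasure M (A i) * emeasure N (B i)) | (A :: nat \<Rightarrow> 'a set) (B :: nat \<Rightarrow> 'b set).
            range A \<subseteq> sets M \<and> range B \<subseteq> sets N \<and> E \<subseteq> (\<Union>i. A i \<times> B i)}"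

definition product_measure :: "'a measure \<Rightarrow> 'b measure \<Rightarrow> ('a \<times> 'b) measure" where
  "product_measure M N =
     measure_of (space M \<times> space N) {A \<times> B | A B. A \<in> sets M \<and> B \<in> sets N} (product_outer M N)"

lemma sets_product_measure [simp, measurable_cong]:
  "sets (product_measure M N) = sets (M \<Otimes>\<^sub>M N)"
  by (simp add: product_measure_def sets_pair_measure sets_measure_of pair_measure_closed)

lemma space_product_measure [simp]: "space (product_measure M N) = space M \<times> space N"
  by (simp add: product_measure_def space_measure_of pair_measure_closed)

lemma product_outer_le:
  assumes "\<And>i. A i \<in> sets M" "\<And>i. B i \<in> sets N" "E \<subseteq> (\<Union>i. A i \<times> B i)"
  shows "product_outer M N E \<le> (\<Sum>i. emeasure M (A i) * emeasure N (B i))"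
  unfolding product_outer_def
  by (intro Inf_lower CollectI exI[of _ A] exI[of _ B] conjI refl image_subsetI assms)

lemma product_outer_less:
  assumes "product_outer M N E < e"
  obtains A B where "\<And>i::nat. A i \<in> sets M" "\<And>i. B i \<in> sets N" "E \<subseteq> (\<Union>i. A i \<times> B i)"
    "(\<Sum>i. emeasure M (A i) * emeasure N (B i)) < e"
proof -
  obtain S where S: "S < e" and "\<exists>A B. S = (\<Sum>i. emeasure M (A i) * emeasure N (B i)) \<and>
      range A \<subseteq> sets M \<and> range B \<subseteq> sets N \<and> E \<subseteq> (\<Union>i::nat. A i \<times> B i)"
    using assms unfolding product_outer_def Inf_less_iff mem_Collect_eq by (elim bexE CollectE) rule
  then obtain A B where "S = (\<Sum>i. emeasure M (A i) * emeasure N (B i))"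
    "range A \<subseteq> sets M" "range B \<subseteq> sets N" "E \<subseteq> (\<Union>i::nat. A i \<times> B i)"
    by (elim exE conjE) rule
  with S show thesis by (intro that[of A B]) auto
qed

lemma product_outer_mono:
  assumes "E \<subseteq> F"
  shows "product_outer M N E \<le> product_outer M N F"
  unfolding product_outer_def[of M N F]
proof (rule Inf_greatest, elim CollectE exE conjE)
  fix x A B
  assume "x = (\<Sum>i::nat. emeasure M (A i) * emeasure N (B i))"
    "range A \<subseteq> sets M" "range B \<subseteq> sets N" "F \<subseteq> (\<Union>i. A i \<times> B i)"
  then show "product_outer M N E \<le> x"
    using product_outer_le[of A M B N E] assms by auto
qed

lemma product_outer_empty: "product_outer M N {} = 0"
  using product_outer_le[of "\<lambda>_. {}" M "\<lambda>_. {}" N "{}"] by simp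

lemma product_outer_countably_subadditive:
  "product_outer M N (\<Union>n::nat. E n) \<le> (\<Sum>n. product_outer M N (E n))"
proof (rule ennreal_le_epsilon)
  let ?O = "product_outer M N"
  fix e :: real assume "0 < e" and fin: "(\<Sum>n. ?O (E n)) < top"
  then have *: "?O (E n) < ?O (E n) + e * (1/2)^Suc n" for n
    by (auto simp add: less_top dest!: ennreal_suminf_lessD)
  define P where "P n A B \<longleftrightarrow> (\<forall>i::nat. A i \<in> sets M) \<and> (\<forall>i. B i \<in> sets N) \<and> E n \<subseteq> (\<Union>i. A i \<times> B i) \<and>
      (\<Sum>i. emeasure M (A i) * emeasure N (B i)) \<le> ?O (E n) + e * (1/2)^Suc n" for n A B
  have "\<exists>A B. P n A B" for n
  proof -
    obtain A B where "\<And>i::nat. A i \<in> sets M" "\<And>i. B i \<in> sets N" "E n \<subseteq> (\<Union>i. A i \<times> B i)"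
      "(\<Sum>i. emeasure M (A i) * emeasure N (B i)) < ?O (E n) + e * (1/2)^Suc n"
      by (rule product_outer_less[OF *[of n]]) (rule that)
    then have "P n A B" by (simp add: P_def less_imp_le)
    then show ?thesis by blast
  qed
  then obtain A B where "\<And>n. P n (A n) (B n)" by metis
  then have AB: "\<And>n i. A n i \<in> sets M" "\<And>n i. B n i \<in> sets N"
    "\<And>n. E n \<subseteq> (\<Union>i. A n i \<times> B n i)"
    "\<And>n. (\<Sum>i. emeasure M (A n i) * emeasure N (B n i)) \<le> ?O (E n) + e * (1/2)^Suc n"
    unfolding P_def by simp_all
  define C where "C = case_prod A \<circ> prod_decode"
  define D where "D = case_prod B \<circ> prod_decode"
  have "?O (\<Union>n. E n) \<le> (\<Sum>k. emeasure M (C k) * emeasure N (D k))"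
  proof (rule product_outer_le)
    show "C k \<in> sets M" "D k \<in> sets N" for k
      using AB(1,2) by (auto simp: C_def D_def split_def)
    show "(\<Union>n. E n) \<subseteq> (\<Union>k. C k \<times> D k)"
    proof
      fix z assume "z \<in> (\<Union>n. E n)"
      then obtain n i where "z \<in> A n i \<times> B n i" using AB(3) by blast
      then have "z \<in> C (prod_encode (n, i)) \<times> D (prod_encode (n, i))"
        by (simp add: C_def D_def)
      then show "z \<in> (\<Union>k. C k \<times> D k)" by blast
    qed
  qed
  also have "\<dots> = (\<Sum>n. \<Sum>i. emeasure M (A n i) * emeasure N (B n i))"
    unfolding C_def D_def comp_def
    by (rule suminf_ennreal_2dimen) (simp add: split_def)
  also have "\<dots> \<le> (\<Sum>n. ?O (E n) + e * (1/2) ^ Suc n)"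
    by (intro suminf_le AB(4)) auto
  also have "\<dots> = (\<Sum>n. ?O (E n)) + (\<Sum>n. ennreal e * ennreal ((1/2) ^ Suc n))"
    using \<open>0 < e\<close> by (subst suminf_add[symmetric])
      (auto simp del: ennreal_suminf_cmult simp add: ennreal_mult[symmetric])
  also have "\<dots> = (\<Sum>n. ?O (E n)) + e"
    unfolding ennreal_suminf_cmult
    by (subst suminf_ennreal_eq[OF zero_le_power power_half_series]) auto
  finally show "?O (\<Union>n. E n) \<le> (\<Sum>n. ?O (E n)) + e" .
qed

lemma outer_measure_space_product_outer: "outer_measure_space (Pow \<Omega>) (product_outer M N)"
  using product_outer_countably_subadditive product_outer_mono product_outer_empty
  by (auto simp: outer_measure_space_def positive_def increasing_def countably_subadditive_def)

lemma product_outer_Un: "product_outer M N (E \<union> F) \<le> product_outer M N E + product_outer M N F"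
proof -
  interpret ring_of_sets UNIV "Pow (UNIV :: ('a \<times> 'b) set)"
    using algebra_Pow algebra_def by blast
  have "subadditive (Pow UNIV) (product_outer M N)"
    using outer_measure_space_product_outer[of UNIV M N]
    unfolding outer_measure_space_def by (blast intro: countably_subadditive_subadditive)
  moreover have "E \<union> F = E \<union> (F - E)" by blast
  ultimately have "product_outer M N (E \<union> F) \<le> product_outer M N E + product_outer M N (F - E)"
    unfolding subadditive_def by (metis Diff_disjoint Pow_UNIV UNIV_I)
  also have "\<dots> \<le> product_outer M N E + product_outer M N F"
    by (intro add_left_mono product_outer_mono) blast
  finally show ?thesis .
qed

lemma rectangle_in_lambda_system:
  assumes A: "A \<in> sets M" and B: "B \<in> sets N"
  shows "A \<times> B \<in> lambda_system (space M \<times> space N) (Pow (space M \<times> space N)) (product_outer M N)"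
proof -
  let ?\<Omega> = "space M \<times> space N" and ?O = "product_outer M N"
  have "?O (X \<inter> (A \<times> B)) + ?O (X - A \<times> B) = ?O X" if "X \<subseteq> ?\<Omega>" for X
  proof (rule antisym)
    have "?O X = ?O ((X \<inter> (A \<times> B)) \<union> (X - A \<times> B))" by (simp add: Int_Diff_Un)
    then show "?O X \<le> ?O (X \<inter> (A \<times> B)) + ?O (X - A \<times> B)" using product_outer_Un by metis
    show "?O (X \<inter> (A \<times> B)) + ?O (X - A \<times> B) \<le> ?O X"
      unfolding product_outer_def[of M N X]
    proof (rule Inf_greatest, clarify)
      fix C :: "nat \<Rightarrow> 'a set" and D :: "nat \<Rightarrow> 'b set"
      assume "range C \<subseteq> sets M" "range D \<subseteq> sets N" and X: "X \<subseteq> (\<Union>i. C i \<times> D i)"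
      then have C: "C i \<in> sets M" and D: "D i \<in> sets N" for i by auto
      let ?m = "emeasure M" and ?n = "emeasure N"
      let ?U = "\<Union>i. (C i \<inter> A) \<times> (D i - B)" and ?V = "\<Union>i. (C i - A) \<times> D i"
      have 1: "?O (X \<inter> (A \<times> B)) \<le> (\<Sum>i. ?m (C i \<inter> A) * ?n (D i \<inter> B))"
        using A B C D X by (intro product_outer_le) auto
      have "?O (X - A \<times> B) \<le> ?O (?U \<union> ?V)" using X by (intro product_outer_mono) blast
      also have "\<dots> \<le> ?O ?U + ?O ?V" by (rule product_outer_Un)
      also have "\<dots> \<le> (\<Sum>i. ?m (C i \<inter> A) * ?n (D i - B)) + (\<Sum>i. ?m (C i - A) * ?n (D i))"
        using A B C D by (intro add_mono product_outer_le) auto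
      finally have 2: "?O (X - A \<times> B) \<le> \<dots>" .
      have "?m (C i) * ?n (D i)
          = ?m (C i \<inter> A) * ?n (D i \<inter> B) + (?m (C i \<inter> A) * ?n (D i - B) + ?m (C i - A) * ?n (D i))" for i
      proof -
        have "?m (C i) = ?m (C i \<inter> A) + ?m (C i - A)"
          using A C by (subst plus_emeasure) (auto simp: Int_Diff_Un)
        moreover have "?n (D i) = ?n (D i \<inter> B) + ?n (D i - B)"
          using B D by (subst plus_emeasure) (auto simp: Int_Diff_Un)
        ultimately show ?thesis by (metis distrib_left distrib_right add.assoc)
      qed
      then have "(\<Sum>i. ?m (C i) * ?n (D i))
          = (\<Sum>i. ?m (C i \<inter> A) * ?n (D i \<inter> B)) +
            ((\<Sum>i. ?m (C i \<inter> A) * ?n (D i - B)) + (\<Sum>i. ?m (C i - A) * ?n (D i)))"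
        by (simp add: suminf_add[symmetric])
      then show "?O (X \<inter> (A \<times> B)) + ?O (X - A \<times> B) \<le> (\<Sum>i. ?m (C i) * ?n (D i))"
        using add_mono[OF 1 2] by simp
    qed
  qed
  then show ?thesis
    using sets.sets_into_space[OF A] sets.sets_into_space[OF B]
    by (auto simp: algebra.lambda_system_eq[OF algebra_Pow])
qed

lemma emeasure_product_measure:
  assumes "E \<in> sets (M \<Otimes>\<^sub>M N)"
  shows "emeasure (product_measure M N) E = product_outer M N E"
proof -
  let ?\<Omega> = "space M \<times> space N" and ?R = "{A \<times> B | A B. A \<in> sets M \<and> B \<in> sets N}"
  let ?L = "lambda_system ?\<Omega> (Pow ?\<Omega>) (product_outer M N)"
  have L: "measure_space ?\<Omega> ?L (product_outer M N)"
    by (rule sigma_algebra.caratheodory_lemma[OF sigma_algebra_Pow outer_measure_space_product_outer])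
  have sub: "sigma_sets ?\<Omega> ?R \<subseteq> ?L"
    using L rectangle_in_lambda_system
    by (intro sigma_algebra.sigma_sets_subset) (auto simp: measure_space_def)
  show ?thesis
  proof (rule emeasure_measure_of[OF product_measure_def])
    show "positive (sets (product_measure M N)) (product_outer M N)"
      by (simp add: positive_def product_outer_empty)
    show "countably_additive (sets (product_measure M N)) (product_outer M N)"
    proof (unfold countably_additive_def, intro allI impI)
      fix E :: "nat \<Rightarrow> ('a \<times> 'b) set"
      assume "range E \<subseteq> sets (product_measure M N)" and dis: "disjoint_family E"
        and "(\<Union>i. E i) \<in> sets (product_measure M N)"
      then have "range E \<subseteq> ?L" "(\<Union>i. E i) \<in> ?L"
        using sub unfolding sets_product_measure sets_pair_measure by blast+
      moreover have "countably_additive ?L (product_outer M N)"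
        using L by (simp only: measure_space_def)
      ultimately show "(\<Sum>i. product_outer M N (E i)) = product_outer M N (\<Union>i. E i)"
        using dis unfolding countably_additive_def by blast
    qed
  qed (use assms pair_measure_closed[of M N] in simp_all)
qed

lemma product_outer_rectangle:
  assumes A: "A \<in> sets M" and B: "B \<in> sets N"
  shows "product_outer M N (A \<times> B) = emeasure M A * emeasure N B"
proof (rule antisym)
  have "product_outer M N (A \<times> B)
      \<le> (\<Sum>i. emeasure M (if i = 0 then A else {}) * emeasure N (if i = (0::nat) then B else {}))"
    using A B by (intro product_outer_le) (auto split: if_splits)
  also have "\<dots> = emeasure M A * emeasure N B"
    by (subst suminf_finite[of "{0}"]) auto
  finally show "product_outer M N (A \<times> B) \<le> emeasure M A * emeasure N B" .
  show "emeasure M A * emeasure N B \<le> product_outer M N (A \<times> B)"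
    unfolding product_outer_def
  proof (rule Inf_greatest, clarify)
    fix C :: "nat \<Rightarrow> 'a set" and D :: "nat \<Rightarrow> 'b set"
    assume "range C \<subseteq> sets M" "range D \<subseteq> sets N" and X: "A \<times> B \<subseteq> (\<Union>i. C i \<times> D i)"
    then have C [measurable]: "C i \<in> sets M" and D: "D i \<in> sets N" for i by auto
    have "emeasure M A * emeasure N B = (\<integral>\<^sup>+x. emeasure N B * indicator A x \<partial>M)"
      using A by (simp add: nn_integral_cmult_indicator mult.commute[of "emeasure M A"])
    also have "\<dots> \<le> (\<integral>\<^sup>+x. (\<Sum>i. emeasure N (D i) * indicator (C i) x) \<partial>M)"
    proof (rule nn_integral_mono)
      fix x
      have "emeasure N B \<le> (\<Sum>i. emeasure N (D i) * indicator (C i) x)" if "x \<in> A"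
      proof -
        let ?D = "\<lambda>i. if x \<in> C i then D i else {}"
        have "emeasure N B \<le> emeasure N (\<Union>i. ?D i)"
        proof (rule emeasure_mono)
          show "B \<subseteq> (\<Union>i. ?D i)"
          proof
            fix y assume "y \<in> B"
            with X that obtain i where "x \<in> C i" "y \<in> D i" by blast
            then have "y \<in> ?D i" by simp
            then show "y \<in> (\<Union>i. ?D i)" by blast
          qed
        qed (use D in auto)
        also have "\<dots> \<le> (\<Sum>i. emeasure N (?D i))"
          by (rule emeasure_subadditive_countably) (use D in auto)
        also have "\<dots> = (\<Sum>i. emeasure N (D i) * indicator (C i) x)"
          by (intro suminf_cong) auto
        finally show ?thesis .
      qed
      then show "emeasure N B * indicator A x \<le> (\<Sum>i. emeasure N (D i) * indicator (C i) x)"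
        by (cases "x \<in> A") auto
    qed
    also have "\<dots> = (\<Sum>i. emeasure M (C i) * emeasure N (D i))"
      by (subst nn_integral_suminf)
         (auto simp: nn_integral_cmult_indicator mult.commute[of "emeasure M _"])
    finally show "emeasure M A * emeasure N B \<le> (\<Sum>i. emeasure M (C i) * emeasure N (D i))" .
  qed
qed

theorem product_measure_eq_pair_measure:
  assumes "sigma_finite_measure M" "sigma_finite_measure N"
  shows "product_measure M N = M \<Otimes>\<^sub>M N"
  by (rule sym, rule pair_measure_eqI[OF assms])
     (auto simp: emeasure_product_measure product_outer_rectangle)

section \<open>Essentially bounded functions and solutions\<close>

text \<open>The values are taken in \<^typ>\<open>ennreal\<close> so that the norm is \<open>0\<close>, and not \<open>-\<infinity>\<close>, over a null space.\<close>

definition Linf_norm :: "'a measure \<Rightarrow> ('a \<Rightarrow> real) \<Rightarrow> ennreal" where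
  "Linf_norm M f = esssup M (\<lambda>x. ennreal \<bar>f x\<bar>)"

definition Linf :: "'a measure \<Rightarrow> ('a \<Rightarrow> real) set" where
  "Linf M = {f \<in> borel_measurable M. Linf_norm M f < \<infinity>}"

abbreviation Rplus :: "real measure" where
  "Rplus \<equiv> lebesgue_on {0<..}"

text \<open>Elements of \<open>L\<^sup>\<infinity>\<close> are classes modulo equality almost everywhere, so non-negativity is required
  almost everywhere only.\<close>

definition nonneg_Linf_solution ::
    "'a measure \<Rightarrow> ('a \<times> 'a \<times> real \<Rightarrow> real) \<Rightarrow> ('a \<times> real \<Rightarrow> real) \<Rightarrow> ('a \<times> real \<Rightarrow> real) \<Rightarrow>
     (real \<Rightarrow> real) \<Rightarrow> ('a \<times> real \<Rightarrow> real) \<Rightarrow> bool" where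
  "nonneg_Linf_solution M K g h G u \<longleftrightarrow>
     u \<in> Linf (product_measure M Rplus) \<and>
     (AE p in product_measure M Rplus. 0 \<le> u p) \<and>
     (AE (x, t) in product_measure M Rplus.
        ennreal (u (x, t)) =
          ennreal (g (x, t)) +
          (\<integral>\<^sup>+s\<in>{0<..<t}. (\<integral>\<^sup>+y. ennreal (K (x, y, t - s) * h (y, s) * G (u (y, s))) \<partial>M) \<partial>lebesgue))"

end

theory Submission
  imports Defs
begin

text \<open>
  The proof compares two solutions \<open>u\<close>, \<open>v\<close> multiplicatively. Write the equation as
  \<open>u = A u + B u\<close>, where \<open>A u\<close> is \<open>g\<close> plus the part of the time integral over \<open>s < T\<close>, and
  \<open>B u\<close> is the part over \<open>s \<ge> T\<close>. Suppose that \<open>u = v\<close> for times below \<open>T\<close>, that \<open>\<sigma> v \<le> u\<close> for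
  times below \<open>S\<close> with \<open>0 \<le> \<sigma> \<le> 1\<close>, and that \<open>A v \<ge> c > 0\<close> for times in \<open>[T, S)\<close>. At these times
  \<open>A u = A v\<close>. As \<open>G\<close> is increasing and concave with \<open>G 0 = 0\<close>, it satisfies
  \<open>\<sigma> G(r) \<le> G(\<sigma> r) \<le> G(r')\<close> for \<open>\<sigma> r \<le> r'\<close>; hence \<open>\<sigma> B v \<le> B u\<close> and
  \<open>u \<ge> A v + \<sigma> B v = \<sigma> v + (1 - \<sigma>) A v \<ge> \<sigma> v + (1 - \<sigma>) c\<close>. As \<open>v\<close> is essentially bounded by
  some \<open>U\<close>, this improves \<open>\<sigma>\<close> to \<open>\<sigma> + (1 - \<sigma>) c / U\<close> (\<open>comparison_improve\<close>). Starting from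
  \<open>\<sigma> = 0\<close>, the iteration converges to \<open>\<sigma> = 1\<close>, that is, to \<open>v \<le> u\<close> below \<open>S\<close> (\<open>comparison\<close>).
  Exchanging \<open>u\<close> and \<open>v\<close> gives equality.

  This is used twice. With \<open>T = 0\<close> and \<open>S = T\<^sub>0\<close> the constant \<open>c = \<beta>\<^sub>0\<close> works because \<open>g \<ge> \<beta>\<^sub>0\<close>
  there. With \<open>T = T\<^sub>0\<close> and \<open>S\<close> arbitrary, the integral over \<open>(0, T\<^sub>0)\<close> is bounded below by
  \<open>\<alpha> G(\<beta>\<^sub>0) e\<^bsup>-S \<lambda>+\<^esup> T\<^sub>0\<close>, since every solution is at least \<open>g \<ge> \<beta>\<^sub>0\<close> on \<open>(0, T\<^sub>0)\<close> and the mass of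
  the kernel is at least \<open>e\<^bsup>-t \<lambda>+\<^esup>\<close> (\<open>history_lower_bound\<close>).

  As \<open>X\<close> is not assumed \<open>\<sigma>\<close>-finite, Fubini's theorem may fail and the inner integral need not be a
  measurable function of \<open>s\<close>. The argument therefore uses only properties that the
  nonnegative integral, being a lower integral, has for arbitrary integrands: monotonicity,
  homogeneity, and additivity over two disjoint measurable sets. Statements almost everywhere on the
  product pass to almost all sections because null sets of the product measure can be covered by
  countably many rectangles of small total measure (\<open>AE_product_measureE\<close>).
\<close>

section \<open>Lower integrals of arbitrary functions\<close>

text \<open>
  The nonnegative integral is the supremum of the integrals of the simple functions below the
  integrand. No integrand in this section needs to be measurable.
\<close>

lemma nn_integral_cmult_le:
  fixes f :: "'a \<Rightarrow> ennreal" and c :: real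
  assumes "0 \<le> c"
  shows "ennreal c * (\<integral>\<^sup>+x. f x \<partial>M) \<le> (\<integral>\<^sup>+x. ennreal c * f x \<partial>M)"
  unfolding nn_integral_def[of M f] SUP_mult_left_ennreal
proof (rule SUP_least, clarify)
  fix g assume g: "simple_function M g" "g \<le> f"
  have [measurable]: "g \<in> borel_measurable M"
    by (rule borel_measurable_simple_function[OF g(1)])
  have "ennreal c * integral\<^sup>S M g = (\<integral>\<^sup>+x. ennreal c * g x \<partial>M)"
    using g(1) by (simp add: nn_integral_cmult nn_integral_eq_simple_integral)
  also have "\<dots> \<le> (\<integral>\<^sup>+x. ennreal c * f x \<partial>M)"
    using g(2) by (intro nn_integral_mono mult_left_mono) (auto simp: le_fun_def)
  finally show "ennreal c * integral\<^sup>S M g \<le> (\<integral>\<^sup>+x. ennreal c * f x \<partial>M)" .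
qed

lemma nn_integral_add_le:
  fixes f g :: "'a \<Rightarrow> ennreal"
  shows "(\<integral>\<^sup>+x. f x \<partial>M) + (\<integral>\<^sup>+x. g x \<partial>M) \<le> (\<integral>\<^sup>+x. f x + g x \<partial>M)"
proof -
  have *: "integral\<^sup>S M a + integral\<^sup>S M b \<le> (\<integral>\<^sup>+x. f x + g x \<partial>M)"
    if a: "simple_function M a" "a \<le> f" and b: "simple_function M b" "b \<le> g" for a b
  proof -
    have "integral\<^sup>S M a + integral\<^sup>S M b = (\<integral>\<^sup>+x. a x + b x \<partial>M)"
      using a(1) b(1)
      by (simp add: nn_integral_add nn_integral_eq_simple_integral borel_measurable_simple_function)
    also have "\<dots> \<le> (\<integral>\<^sup>+x. f x + g x \<partial>M)"
      using a(2) b(2) by (intro nn_integral_mono add_mono) (auto simp: le_fun_def)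
    finally show ?thesis .
  qed
  have ne: "{a. simple_function M a \<and> a \<le> f} \<noteq> {}" for f :: "'a \<Rightarrow> ennreal"
    by (auto intro!: exI[of _ "\<lambda>_. 0"] simp: le_fun_def)
  have "integral\<^sup>S M a + (\<integral>\<^sup>+x. g x \<partial>M) \<le> (\<integral>\<^sup>+x. f x + g x \<partial>M)"
    if "simple_function M a" "a \<le> f" for a
    unfolding nn_integral_def[of M g] ennreal_SUP_add_right[OF ne]
    using * that by (intro SUP_least) auto
  then show ?thesis
    unfolding nn_integral_def[of M f] ennreal_SUP_add_left[OF ne, symmetric]
    by (intro SUP_least) auto
qed

lemma nn_integral_Un_disjoint:
  fixes f :: "'a \<Rightarrow> ennreal"
  assumes AB [measurable]: "A \<in> sets M" "B \<in> sets M" and dis: "A \<inter> B = {}"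
  shows "(\<integral>\<^sup>+x\<in>A \<union> B. f x \<partial>M) = (\<integral>\<^sup>+x\<in>A. f x \<partial>M) + (\<integral>\<^sup>+x\<in>B. f x \<partial>M)"
proof (rule antisym)
  have ind: "indicator (A \<union> B) x = (indicator A x + indicator B x :: ennreal)" for x
    using dis by (auto simp: indicator_def)
  show "(\<integral>\<^sup>+x\<in>A. f x \<partial>M) + (\<integral>\<^sup>+x\<in>B. f x \<partial>M) \<le> (\<integral>\<^sup>+x\<in>A \<union> B. f x \<partial>M)"
    using nn_integral_add_le[of M "\<lambda>x. f x * indicator A x" "\<lambda>x. f x * indicator B x"]
    by (simp add: ind distrib_left)
  show "(\<integral>\<^sup>+x\<in>A \<union> B. f x \<partial>M) \<le> (\<integral>\<^sup>+x\<in>A. f x \<partial>M) + (\<integral>\<^sup>+x\<in>B. f x \<partial>M)"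
    unfolding nn_integral_def[of M "\<lambda>x. f x * indicator (A \<union> B) x"]
  proof (rule SUP_least, clarify)
    fix g assume g: "simple_function M g" "g \<le> (\<lambda>x. f x * indicator (A \<union> B) x)"
    have [measurable]: "g \<in> borel_measurable M"
      by (rule borel_measurable_simple_function[OF g(1)])
    have le: "g x \<le> f x * indicator (A \<union> B) x" for x
      using g(2) by (simp add: le_fun_def)
    have "g x = g x * indicator A x + g x * indicator B x" for x
      using le[of x] dis by (cases "x \<in> A"; cases "x \<in> B") (auto simp: indicator_def)
    then have "integral\<^sup>S M g = (\<integral>\<^sup>+x. g x * indicator A x + g x * indicator B x \<partial>M)"
      using g(1) by (simp flip: nn_integral_eq_simple_integral)
    also have "\<dots> = (\<integral>\<^sup>+x\<in>A. g x \<partial>M) + (\<integral>\<^sup>+x\<in>B. g x \<partial>M)"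
      by (simp add: nn_integral_add)
    also have "\<dots> \<le> (\<integral>\<^sup>+x\<in>A. f x \<partial>M) + (\<integral>\<^sup>+x\<in>B. f x \<partial>M)"
    proof (intro add_mono nn_integral_mono)
      show "g x * indicator A x \<le> f x * indicator A x" for x
        using le[of x] by (auto simp: indicator_def split: if_splits)
      show "g x * indicator B x \<le> f x * indicator B x" for x
        using le[of x] by (auto simp: indicator_def split: if_splits)
    qed
    finally show "integral\<^sup>S M g \<le> (\<integral>\<^sup>+x\<in>A. f x \<partial>M) + (\<integral>\<^sup>+x\<in>B. f x \<partial>M)" .
  qed
qed

section \<open>Sections of null sets\<close>

lemma product_outer_swap_le: "product_outer N M (prod.swap ` E) \<le> product_outer M N E"
  unfolding product_outer_def[of M N]
proof (rule Inf_greatest, clarify)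
  fix A :: "nat \<Rightarrow> 'b set" and B :: "nat \<Rightarrow> 'a set"
  assume A: "range A \<subseteq> sets M" and B: "range B \<subseteq> sets N" and E: "E \<subseteq> (\<Union>i. A i \<times> B i)"
  have "product_outer N M (prod.swap ` E) \<le> (\<Sum>i. emeasure N (B i) * emeasure M (A i))"
    by (rule product_outer_le) (use A B E in auto)
  then show "product_outer N M (prod.swap ` E) \<le> (\<Sum>i. emeasure M (A i) * emeasure N (B i))"
    by (simp add: mult.commute)
qed

text \<open>
  If rectangles \<open>A\<^sub>i \<times> B\<^sub>i\<close> cover \<open>E\<close>, the section of \<open>E\<close> at \<open>y\<close> has measure at most
  \<open>f(y) = \<Sum>i. \<mu>(A\<^sub>i) 1\<^bsub>B\<^sub>i\<^esub>(y)\<close>, and the integral of \<open>f\<close> is the total measure of the rectangles. The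
  infimum of such functions along covers of total measure at most \<open>1 / (n + 1)\<close> vanishes almost
  everywhere.
\<close>

lemma AE_section_null:
  assumes E: "E \<in> sets (M \<Otimes>\<^sub>M N)" and null: "product_outer M N E = 0"
  shows "AE y in N. AE x in M. (x, y) \<notin> E"
proof -
  define P where "P n A B \<longleftrightarrow> (\<forall>i::nat. A i \<in> sets M) \<and> (\<forall>i. B i \<in> sets N) \<and> E \<subseteq> (\<Union>i. A i \<times> B i) \<and>
      (\<Sum>i. emeasure M (A i) * emeasure N (B i)) \<le> ennreal (1 / real (Suc n))" for n A B
  have "\<exists>A B. P n A B" for n
  proof -
    have *: "product_outer M N E < ennreal (1 / real (Suc n))" by (simp add: null)
    obtain A B where "\<And>i::nat. A i \<in> sets M" "\<And>i. B i \<in> sets N" "E \<subseteq> (\<Union>i. A i \<times> B i)"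
      "(\<Sum>i. emeasure M (A i) * emeasure N (B i)) < ennreal (1 / real (Suc n))"
      by (rule product_outer_less[OF *]) (rule that)
    then have "P n A B" by (simp add: P_def less_imp_le)
    then show ?thesis by blast
  qed
  then obtain A B where "\<And>n. P n (A n) (B n)" by metis
  then have A [measurable]: "\<And>n i. A n i \<in> sets M" and B [measurable]: "\<And>n i. B n i \<in> sets N"
    and cover: "\<And>n. E \<subseteq> (\<Union>i. A n i \<times> B n i)"
    and small: "\<And>n. (\<Sum>i. emeasure M (A n i) * emeasure N (B n i)) \<le> ennreal (1 / real (Suc n))"
    unfolding P_def by simp_all
  define f where "f n y = (\<Sum>i. emeasure M (A n i) * indicator (B n i) y)" for n y
  have f_meas [measurable]: "f n \<in> borel_measurable N" for n
    unfolding f_def by measurable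
  have f_int: "(\<integral>\<^sup>+y. f n y \<partial>N) \<le> ennreal (1 / real (Suc n))" for n
    using small[of n] unfolding f_def
    by (subst nn_integral_suminf) (auto simp: nn_integral_cmult_indicator)
  have "(\<integral>\<^sup>+y. (INF n. f n y) \<partial>N) = 0"
  proof -
    have "(\<integral>\<^sup>+y. (INF n. f n y) \<partial>N) \<le> ennreal (1 / real (Suc n))" for n
      by (rule order_trans[OF nn_integral_mono f_int[of n]]) (auto intro: INF_lower)
    moreover have "(\<lambda>n. ennreal (1 / real (Suc n))) \<longlonglongrightarrow> ennreal 0"
      by (intro tendsto_ennrealI LIMSEQ_Suc lim_1_over_n)
    ultimately have "(\<integral>\<^sup>+y. (INF n. f n y) \<partial>N) \<le> ennreal 0"
      by (intro LIMSEQ_le_const) auto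
    then show ?thesis by simp
  qed
  then have "AE y in N. (INF n. f n y) = 0"
    by (subst (asm) nn_integral_0_iff_AE) auto
  then show ?thesis
  proof eventually_elim
    case (elim y)
    let ?E = "(\<lambda>x. (x, y)) -` E"
    have Ey: "?E \<in> sets M" by (rule sets_Pair2[OF E])
    have "emeasure M ?E \<le> f n y" for n
    proof -
      let ?A = "\<lambda>i. if y \<in> B n i then A n i else {}"
      have "emeasure M ?E \<le> emeasure M (\<Union>i. ?A i)"
      proof (rule emeasure_mono)
        show "?E \<subseteq> (\<Union>i. ?A i)"
        proof
          fix x assume "x \<in> ?E"
          with cover[of n] obtain i where "x \<in> A n i" "y \<in> B n i" by blast
          then have "x \<in> ?A i" by simp
          then show "x \<in> (\<Union>i. ?A i)" by blast
        qed
      qed (use A in auto)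
      also have "\<dots> \<le> (\<Sum>i. emeasure M (?A i))"
        by (rule emeasure_subadditive_countably) (use A in auto)
      also have "\<dots> = f n y"
        unfolding f_def by (intro suminf_cong) auto
      finally show ?thesis .
    qed
    then have "emeasure M ?E \<le> (INF n. f n y)" by (intro INF_greatest)
    with elim Ey have "?E \<in> null_sets M" by (auto intro: null_setsI)
    then show ?case by (rule AE_I') auto
  qed
qed

text \<open>
  Almost every section of a null set of the product measure is null, in either direction. Neither
  factor has to be \<open>\<sigma>\<close>-finite.
\<close>

lemma AE_product_measureE:
  assumes "AE z in product_measure M N. P z"
  shows "AE y in N. AE x in M. P (x, y)" and "AE x in M. AE y in N. P (x, y)"
proof -
  obtain E where E: "E \<in> null_sets (product_measure M N)"
    and sub: "{z \<in> space (product_measure M N). \<not> P z} \<subseteq> E"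
    using assms unfolding eventually_ae_filter by blast
  then have sets: "E \<in> sets (M \<Otimes>\<^sub>M N)" and null: "product_outer M N E = 0"
    by (auto simp: null_sets_def emeasure_product_measure)
  have P: "P (x, y)" if "x \<in> space M" "y \<in> space N" "(x, y) \<notin> E" for x y
    using sub that by auto
  show "AE y in N. AE x in M. P (x, y)"
    using AE_section_null[OF sets null] AE_space
  proof eventually_elim
    case (elim y)
    from elim(1) AE_space show ?case by eventually_elim (rule P[OF _ elim(2)])
  qed
  have swap: "prod.swap ` E = (\<lambda>(y, x). (x, y)) -` E \<inter> space (N \<Otimes>\<^sub>M M)"
    using sets.sets_into_space[OF sets] by (force simp: space_pair_measure)
  have sets': "prod.swap ` E \<in> sets (N \<Otimes>\<^sub>M M)"
    unfolding swap by (rule measurable_sets[OF measurable_pair_swap' sets])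
  have "product_outer N M (prod.swap ` E) = 0"
    using product_outer_swap_le[of N M E] null by simp
  from AE_section_null[OF sets' this] AE_space
  show "AE x in M. AE y in N. P (x, y)"
  proof eventually_elim
    case (elim x)
    from elim(1) AE_space show ?case
    proof eventually_elim
      case (elim y)
      with \<open>x \<in> space M\<close> show ?case by (intro P) force+
    qed
  qed
qed

text \<open>A cylinder over a null set is null even if the other factor has infinite measure, as \<open>0 * \<infinity> = 0\<close>.\<close>

lemma AE_product_measure_fst:
  assumes "AE x in M. P x"
  shows "AE z in product_measure M N. P (fst z)"
proof -
  obtain E where E: "E \<in> null_sets M" and sub: "{x \<in> space M. \<not> P x} \<subseteq> E"
    using assms unfolding eventually_ae_filter by blast
  have "E \<times> space N \<in> null_sets (product_measure M N)"
    using E by (auto simp: null_sets_def emeasure_product_measure product_outer_rectangle)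
  then show ?thesis by (rule AE_I') (use sub in auto)
qed

lemma AE_Rplus_iff: "(AE t in Rplus. P t) \<longleftrightarrow> (AE t in lebesgue. 0 < t \<longrightarrow> P t)"
  by (subst AE_restrict_space_iff) auto

lemma AE_Rplus_reflect:
  assumes "AE r in Rplus. P r"
  shows "AE s in lebesgue. s < t \<longrightarrow> P (t - s)"
proof -
  \<comment> \<open>\<open>P\<close> need not be measurable, so the reflection is applied to a Borel null set containing the
    exceptions.\<close>
  obtain E where E: "E \<in> null_sets lborel" and sub: "{r. \<not> (0 < r \<longrightarrow> P r)} \<subseteq> E"
    using assms unfolding AE_Rplus_iff AE_completion_iff by (auto simp: eventually_ae_filter)
  have [measurable]: "E \<in> sets borel" using E by auto
  have "AE s in lborel. t + (-1) * s \<notin> E"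
    using AE_not_in[OF E] by (intro AE_borel_affine) auto
  then have "AE s in lborel. s < t \<longrightarrow> P (t - s)"
  proof eventually_elim
    case (elim s)
    then have "t - s \<notin> E" by simp
    with sub have "0 < t - s \<longrightarrow> P (t - s)" by blast
    then show ?case by simp
  qed
  then show ?thesis by (simp add: AE_completion_iff)
qed

section \<open>Comparison of two solutions\<close>

lemma concave_on_scale:
  fixes G :: "real \<Rightarrow> real"
  assumes "concave_on {0..} G" "G 0 = 0" "0 \<le> \<sigma>" "\<sigma> \<le> 1" "0 \<le> r"
  shows "\<sigma> * G r \<le> G (\<sigma> * r)"
  using concave_onD[OF assms(1), of \<sigma> 0 r] assms by simp

lemma Linf_AE_bounded:
  assumes "f \<in> Linf M"
  obtains U where "AE x in M. \<bar>f x\<bar> \<le> U"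
proof -
  have fin: "Linf_norm M f < top" using assms by (simp add: Linf_def)
  have "AE x in M. \<bar>f x\<bar> \<le> enn2real (Linf_norm M f)"
    using esssup_AE[of "\<lambda>x. ennreal \<bar>f x\<bar>" M]
  proof eventually_elim
    case (elim x)
    then have "ennreal \<bar>f x\<bar> \<le> ennreal (enn2real (Linf_norm M f))"
      using fin by (simp add: Linf_norm_def)
    then show ?case by simp
  qed
  then show thesis by (rule that)
qed

text \<open>
  The data of the integral equation, with the structural conditions under which the comparison works.
  No measurability is required.
\<close>

locale concave_volterra =
  fixes M :: "'a measure" and K :: "'a \<times> 'a \<times> real \<Rightarrow> real"
    and g h :: "'a \<times> real \<Rightarrow> real" and G :: "real \<Rightarrow> real"
  assumes K_nonneg: "\<And>x y t. x \<in> space M \<Longrightarrow> y \<in> space M \<Longrightarrow> 0 < t \<Longrightarrow> 0 \<le> K (x, y, t)"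
    and h_nonneg: "\<And>x t. x \<in> space M \<Longrightarrow> 0 < t \<Longrightarrow> 0 \<le> h (x, t)"
    and G_mono: "\<And>r s. 0 \<le> r \<Longrightarrow> r \<le> s \<Longrightarrow> G r \<le> G s"
    and G_0: "G 0 = 0"
    and G_concave: "concave_on {0..} G"
begin

abbreviation XT :: "('a \<times> real) measure" where
  "XT \<equiv> product_measure M Rplus"

lemma G_nonneg: "0 \<le> r \<Longrightarrow> 0 \<le> G r"
  using G_mono[of 0 r] G_0 by simp

text \<open>The inner integral of the equation: what time \<open>s\<close> contributes to \<open>u(x, t)\<close>. It is meant for \<open>0 < s < t\<close>.\<close>

definition flux :: "('a \<times> real \<Rightarrow> real) \<Rightarrow> 'a \<Rightarrow> real \<Rightarrow> real \<Rightarrow> ennreal" where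
  "flux u x t s = (\<integral>\<^sup>+y. ennreal (K (x, y, t - s) * h (y, s) * G (u (y, s))) \<partial>M)"

text \<open>The part of the integral term of the equation at \<open>(x, t)\<close> that comes from the times \<open>s \<in> I\<close>.\<close>

definition history :: "real set \<Rightarrow> ('a \<times> real \<Rightarrow> real) \<Rightarrow> 'a \<Rightarrow> real \<Rightarrow> ennreal" where
  "history I u x t = (\<integral>\<^sup>+s\<in>I. flux u x t s \<partial>lebesgue)"

lemma flux_scale:
  assumes x: "x \<in> space M" and s: "0 < s" "s < t" and \<sigma>: "0 \<le> \<sigma>" "\<sigma> \<le> 1"
    and le: "AE y in M. 0 \<le> v (y, s) \<and> \<sigma> * v (y, s) \<le> u (y, s)"
  shows "ennreal \<sigma> * flux v x t s \<le> flux u x t s"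
proof -
  have "ennreal \<sigma> * flux v x t s
      \<le> (\<integral>\<^sup>+y. ennreal \<sigma> * ennreal (K (x, y, t - s) * h (y, s) * G (v (y, s))) \<partial>M)"
    unfolding flux_def by (rule nn_integral_cmult_le[OF \<sigma>(1)])
  also have "\<dots> \<le> flux u x t s"
    unfolding flux_def
  proof (rule nn_integral_mono_AE)
    show "AE y in M. ennreal \<sigma> * ennreal (K (x, y, t - s) * h (y, s) * G (v (y, s)))
        \<le> ennreal (K (x, y, t - s) * h (y, s) * G (u (y, s)))"
      using le AE_space
    proof eventually_elim
      case (elim y)
      then have v: "0 \<le> v (y, s)" and uv: "\<sigma> * v (y, s) \<le> u (y, s)" by auto
      have Kh: "0 \<le> K (x, y, t - s) * h (y, s)"
        using K_nonneg[OF x elim(2), of "t - s"] h_nonneg[OF elim(2) s(1)] s by simp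
      have "\<sigma> * G (v (y, s)) \<le> G (\<sigma> * v (y, s))"
        by (rule concave_on_scale[OF G_concave G_0 \<sigma> v])
      also have "\<dots> \<le> G (u (y, s))"
        using v uv \<sigma> by (intro G_mono) auto
      finally have "\<sigma> * (K (x, y, t - s) * h (y, s) * G (v (y, s)))
          \<le> K (x, y, t - s) * h (y, s) * G (u (y, s))"
        using mult_left_mono[OF _ Kh] by (metis mult.left_commute)
      then show ?case
        using \<sigma>(1) by (simp add: ennreal_mult'[symmetric] ennreal_leI)
    qed
  qed
  finally show ?thesis .
qed

lemma history_scale:
  assumes x: "x \<in> space M" and I: "I \<subseteq> {0<..<t}" and \<sigma>: "0 \<le> \<sigma>" "\<sigma> \<le> 1"
    and le: "AE s in lebesgue. s \<in> I \<longrightarrow> (AE y in M. 0 \<le> v (y, s) \<and> \<sigma> * v (y, s) \<le> u (y, s))"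
  shows "ennreal \<sigma> * history I v x t \<le> history I u x t"
proof -
  have "ennreal \<sigma> * history I v x t \<le> (\<integral>\<^sup>+s. ennreal \<sigma> * (flux v x t s * indicator I s) \<partial>lebesgue)"
    unfolding history_def by (rule nn_integral_cmult_le[OF \<sigma>(1)])
  also have "\<dots> \<le> history I u x t"
    unfolding history_def
  proof (rule nn_integral_mono_AE)
    show "AE s in lebesgue. ennreal \<sigma> * (flux v x t s * indicator I s) \<le> flux u x t s * indicator I s"
      using le
    proof eventually_elim
      case (elim s)
      show ?case
      proof (cases "s \<in> I")
        case True
        then show ?thesis using elim I flux_scale[OF x _ _ \<sigma>, of s t v u] by auto
      qed simp
    qed
  qed
  finally show ?thesis .
qed

lemma history_split:
  "history {0<..<t} u x t = history ({0<..<t} \<inter> {..<T}) u x t + history ({0<..<t} \<inter> {T..}) u x t"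
proof -
  have eq: "{0<..<t} = ({0<..<t} \<inter> {..<T}) \<union> ({0<..<t} \<inter> {T..})"
    and dis: "({0<..<t} \<inter> {..<T}) \<inter> ({0<..<t} \<inter> {T..}) = {}" by auto
  show ?thesis
    unfolding history_def by (subst eq, rule nn_integral_Un_disjoint[OF _ _ dis]) auto
qed

lemma solution_AE:
  assumes "nonneg_Linf_solution M K g h G u"
  shows "AE z in XT. 0 \<le> u z"
    and "AE z in XT. ennreal (u z) = ennreal (g z) + history {0<..<snd z} u (fst z) (snd z)"
  using assms by (auto simp: nonneg_Linf_solution_def history_def flux_def split_beta)

lemma AE_sections:
  assumes "AE z in XT. snd z < S \<longrightarrow> P z"
  shows "AE s in lebesgue. 0 < s \<and> s < S \<longrightarrow> (AE y in M. P (y, s))"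
proof -
  have "AE s in lebesgue. 0 < s \<longrightarrow> (AE y in M. s < S \<longrightarrow> P (y, s))"
    using AE_product_measureE(1)[OF assms] by (simp add: AE_Rplus_iff)
  then show ?thesis by eventually_elim auto
qed

lemma AE_XT_space: "AE z in XT. fst z \<in> space M \<and> 0 < snd z"
  using AE_space[of XT] by eventually_elim auto

text \<open>The improvement step of the comparison. It is trivial at times below \<open>T\<close>, where \<open>u = v\<close>.\<close>

lemma comparison_improve:
  assumes u: "nonneg_Linf_solution M K g h G u" and v: "nonneg_Linf_solution M K g h G v"
    and U: "AE z in XT. v z \<le> U" and c: "0 < c" "c \<le> U" and \<sigma>: "0 \<le> \<sigma>" "\<sigma> \<le> 1"
    and past: "AE z in XT. snd z < T \<longrightarrow> u z = v z"
    and forcing: "AE z in XT. T \<le> snd z \<and> snd z < S \<longrightarrow>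
        ennreal c \<le> ennreal (g z) + history ({0<..<snd z} \<inter> {..<T}) v (fst z) (snd z)"
    and le: "AE z in XT. snd z < S \<longrightarrow> \<sigma> * v z \<le> u z"
  shows "AE z in XT. snd z < S \<longrightarrow> (\<sigma> + (1 - \<sigma>) * (c / U)) * v z \<le> u z"
proof -
  have "AE z in XT. snd z < T \<longrightarrow> 0 \<le> v z \<and> 1 * v z \<le> u z"
    using solution_AE(1)[OF v] past by eventually_elim auto
  note past_sec = AE_sections[OF this]
  have "AE z in XT. snd z < S \<longrightarrow> 0 \<le> v z \<and> \<sigma> * v z \<le> u z"
    using solution_AE(1)[OF v] le by eventually_elim auto
  note le_sec = AE_sections[OF this]
  show ?thesis
    using solution_AE[OF v] solution_AE[OF u] U past forcing AE_XT_space
  proof eventually_elim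
    case (elim z)
    obtain x t where z: "z = (x, t)" by (cases z)
    define \<kappa> where "\<kappa> = c / U"
    have \<kappa>: "0 \<le> \<kappa>" "\<kappa> \<le> 1" and \<kappa>U: "\<kappa> * U = c" using c by (auto simp: \<kappa>_def)
    show ?case
    proof (intro impI)
      assume "snd z < S"
      show "(\<sigma> + (1 - \<sigma>) * (c / U)) * v z \<le> u z"
      proof (cases "snd z < T")
        case True
        have "(1 - \<sigma>) * \<kappa> \<le> 1 - \<sigma>" using \<kappa> \<sigma> by (intro mult_left_le) auto
        then have "(\<sigma> + (1 - \<sigma>) * \<kappa>) * v z \<le> v z"
          using elim(1) by (intro mult_left_le_one_le) (use \<kappa> \<sigma> in auto)
        then show ?thesis using True elim by (simp add: \<kappa>_def)
      next
        case False
        define A where "A w = ennreal (g z) + history ({0<..<t} \<inter> {..<T}) w x t" for w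
        define B where "B w = history ({0<..<t} \<inter> {T..}) w x t" for w
        have x: "x \<in> space M" using elim z by auto
        have uAB: "ennreal (u z) = A u + B u" and vAB: "ennreal (v z) = A v + B v"
          using elim z unfolding A_def B_def
          by (auto simp: history_split[of t _ x T] add.assoc)
        have cA: "ennreal c \<le> A v" using elim z False \<open>snd z < S\<close> by (auto simp: A_def)
        have "history ({0<..<t} \<inter> {..<T}) v x t \<le> history ({0<..<t} \<inter> {..<T}) u x t"
        proof -
          have "AE s in lebesgue. s \<in> {0<..<t} \<inter> {..<T} \<longrightarrow>
              (AE y in M. 0 \<le> v (y, s) \<and> 1 * v (y, s) \<le> u (y, s))"
            using past_sec by eventually_elim auto
          from history_scale[OF x _ _ _ this, of t] show ?thesis by simp
        qed
        then have A_le: "A v \<le> A u" unfolding A_def by (rule add_left_mono)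
        have B_le: "ennreal \<sigma> * B v \<le> B u"
          unfolding B_def
        proof (rule history_scale[OF x _ \<sigma>])
          show "AE s in lebesgue. s \<in> {0<..<t} \<inter> {T..} \<longrightarrow>
              (AE y in M. 0 \<le> v (y, s) \<and> \<sigma> * v (y, s) \<le> u (y, s))"
            using le_sec by eventually_elim (use \<open>snd z < S\<close> z in auto)
        qed auto
        have "ennreal (\<sigma> * v z + (1 - \<sigma>) * c) = ennreal \<sigma> * (A v + B v) + ennreal (1 - \<sigma>) * ennreal c"
          using elim(1) \<sigma> c by (simp add: ennreal_mult' vAB)
        also have "\<dots> \<le> ennreal \<sigma> * (A v + B v) + ennreal (1 - \<sigma>) * A v"
          by (intro add_left_mono mult_left_mono cA) auto
        also have "\<dots> = (ennreal \<sigma> + ennreal (1 - \<sigma>)) * A v + ennreal \<sigma> * B v"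
          by (simp add: distrib_left distrib_right add_ac)
        also have "ennreal \<sigma> + ennreal (1 - \<sigma>) = 1"
          using \<sigma> by (simp flip: ennreal_plus)
        also have "1 * A v + ennreal \<sigma> * B v \<le> A u + B u"
          using A_le B_le by (simp add: add_mono)
        finally have "\<sigma> * v z + (1 - \<sigma>) * c \<le> u z"
          using elim(3) by (simp flip: uAB)
        moreover have "\<kappa> * v z \<le> c"
          using mult_left_mono[OF _ \<kappa>(1), of "v z" U] elim \<kappa>U by simp
        then have "(1 - \<sigma>) * (\<kappa> * v z) \<le> (1 - \<sigma>) * c"
          using \<sigma> by (intro mult_left_mono) auto
        ultimately show ?thesis by (simp add: \<kappa>_def[symmetric] algebra_simps)
      qed
    qed
  qed
qed

lemma comparison:
  assumes u: "nonneg_Linf_solution M K g h G u" and v: "nonneg_Linf_solution M K g h G v"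
    and c: "0 < c"
    and past: "AE z in XT. snd z < T \<longrightarrow> u z = v z"
    and forcing: "AE z in XT. T \<le> snd z \<and> snd z < S \<longrightarrow>
        ennreal c \<le> ennreal (g z) + history ({0<..<snd z} \<inter> {..<T}) v (fst z) (snd z)"
  shows "AE z in XT. snd z < S \<longrightarrow> v z \<le> u z"
proof -
  obtain U\<^sub>0 where U\<^sub>0: "AE z in XT. \<bar>v z\<bar> \<le> U\<^sub>0"
    using v Linf_AE_bounded unfolding nonneg_Linf_solution_def by blast
  define U where "U = max c U\<^sub>0"
  have U: "AE z in XT. v z \<le> U" using U\<^sub>0 by eventually_elim (auto simp: U_def)
  have cU: "c \<le> U" by (simp add: U_def)
  define \<kappa> where "\<kappa> = c / U"
  have \<kappa>: "0 < \<kappa>" "\<kappa> \<le> 1" using c cU by (auto simp: \<kappa>_def)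
  \<comment> \<open>The map \<open>\<sigma> \<mapsto> \<sigma> + (1 - \<sigma>) \<kappa>\<close> multiplies \<open>1 - \<sigma>\<close> by \<open>1 - \<kappa>\<close>.\<close>
  have iter: "AE z in XT. snd z < S \<longrightarrow> (1 - (1 - \<kappa>) ^ n) * v z \<le> u z" for n
  proof (induction n)
    case 0
    show ?case using solution_AE(1)[OF u] by eventually_elim simp
  next
    case (Suc n)
    have "0 \<le> 1 - (1 - \<kappa>) ^ n" "1 - (1 - \<kappa>) ^ n \<le> 1"
      using \<kappa> by (auto intro: power_le_one)
    from comparison_improve[OF u v U c cU this past forcing Suc]
    show ?case by (simp add: \<kappa>_def[symmetric] algebra_simps)
  qed
  then have "AE z in XT. \<forall>n. snd z < S \<longrightarrow> (1 - (1 - \<kappa>) ^ n) * v z \<le> u z"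
    unfolding AE_all_countable by blast
  then show ?thesis
  proof (eventually_elim, intro impI)
    fix z assume *: "\<forall>n. snd z < S \<longrightarrow> (1 - (1 - \<kappa>) ^ n) * v z \<le> u z" and "snd z < S"
    have "(\<lambda>n. (1 - (1 - \<kappa>) ^ n) * v z) \<longlonglongrightarrow> (1 - 0) * v z"
      using \<kappa> by (intro tendsto_intros LIMSEQ_power_zero) auto
    then show "v z \<le> u z"
      using * \<open>snd z < S\<close> by (intro LIMSEQ_le_const2[of _ "v z"]) auto
  qed
qed

text \<open>
  The bound on \<open>K\<close> holds for almost every pair \<open>(x, r)\<close>. It is needed at \<open>r = t - s\<close> for almost all
  \<open>s \<in> (0, t)\<close>; this holds for almost every \<open>x\<close> and every \<open>t\<close>, by reflecting the section at \<open>x\<close>.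
\<close>

lemma history_lower_bound:
  assumes a: "0 \<le> a" "\<And>y s. y \<in> space M \<Longrightarrow> 0 < s \<Longrightarrow> a \<le> h (y, s)"
    and b: "0 \<le> b" "AE z in XT. snd z < T \<longrightarrow> b \<le> u z"
    and T: "0 < T" and lam: "0 \<le> lam"
    and K: "AE z in XT. ennreal (exp (- snd z * lam)) \<le> (\<integral>\<^sup>+y. ennreal (K (fst z, y, snd z)) \<partial>M)"
  shows "AE z in XT. T \<le> snd z \<and> snd z < S \<longrightarrow>
      ennreal (a * G b * exp (- S * lam) * T) \<le> history ({0<..<snd z} \<inter> {..<T}) u (fst z) (snd z)"
proof -
  have u_sec: "AE s in lebesgue. 0 < s \<and> s < T \<longrightarrow> (AE y in M. b \<le> u (y, s))"
    by (rule AE_sections[OF b(2)])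
  have "AE x in M. AE r in Rplus. ennreal (exp (- r * lam)) \<le> (\<integral>\<^sup>+y. ennreal (K (x, y, r)) \<partial>M)"
    using AE_product_measureE(2)[OF K] by simp
  from AE_product_measure_fst[OF this] AE_XT_space
  show ?thesis
  proof (eventually_elim, intro impI)
    fix z assume K_sec: "AE r in Rplus. ennreal (exp (- r * lam)) \<le> (\<integral>\<^sup>+y. ennreal (K (fst z, y, r)) \<partial>M)"
      and z: "fst z \<in> space M \<and> 0 < snd z" and t: "T \<le> snd z \<and> snd z < S"
    obtain x t where zx: "z = (x, t)" by (cases z)
    let ?I = "{0<..<t} \<inter> {..<T}"
    have I: "?I = {0<..<T}" using t zx by auto
    have ab: "0 \<le> a * G b" using a(1) G_nonneg[OF b(1)] by simp
    have "AE s in lebesgue. ennreal (a * G b * exp (- S * lam)) * indicator ?I s \<le> flux u x t s * indicator ?I s"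
      using u_sec AE_Rplus_reflect[OF K_sec, of t]
    proof eventually_elim
      case (elim s)
      show ?case
      proof (cases "s \<in> ?I")
        case True
        then have s: "0 < s" "s < t" "s < T" by auto
        have "- S * lam \<le> - (t - s) * lam"
          using t zx s lam by (intro mult_right_mono) auto
        then have "ennreal (exp (- S * lam)) \<le> ennreal (exp (- (t - s) * lam))"
          by (intro ennreal_leI) simp
        also have "\<dots> \<le> (\<integral>\<^sup>+y. ennreal (K (x, y, t - s)) \<partial>M)" using elim s zx by simp
        finally have "ennreal (a * G b * exp (- S * lam))
            \<le> ennreal (a * G b) * (\<integral>\<^sup>+y. ennreal (K (x, y, t - s)) \<partial>M)"
          using ab by (simp add: ennreal_mult mult_left_mono)
        also have "\<dots> \<le> (\<integral>\<^sup>+y. ennreal (a * G b) * ennreal (K (x, y, t - s)) \<partial>M)"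
          by (rule nn_integral_cmult_le[OF ab])
        also have "\<dots> \<le> flux u x t s"
          unfolding flux_def
        proof (rule nn_integral_mono_AE)
          from elim(1) s have "AE y in M. b \<le> u (y, s)" by simp
          from this AE_space show "AE y in M. ennreal (a * G b) * ennreal (K (x, y, t - s))
              \<le> ennreal (K (x, y, t - s) * h (y, s) * G (u (y, s)))"
          proof eventually_elim
            case (elim y)
            have "0 \<le> K (x, y, t - s)" using K_nonneg z zx elim s by auto
            moreover have "a * G b \<le> h (y, s) * G (u (y, s))"
              using elim s a b h_nonneg by (intro mult_mono a(2) G_mono G_nonneg) auto
            ultimately have "K (x, y, t - s) * (a * G b) \<le> K (x, y, t - s) * (h (y, s) * G (u (y, s)))"
              by (rule mult_left_mono[rotated])
            then show ?case using ab by (simp add: ennreal_mult'[symmetric] ennreal_leI mult_ac)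
          qed
        qed
        finally show ?thesis using True by simp
      qed simp
    qed
    then have "(\<integral>\<^sup>+s. ennreal (a * G b * exp (- S * lam)) * indicator ?I s \<partial>lebesgue) \<le> history ?I u x t"
      unfolding history_def by (rule nn_integral_mono_AE)
    also have "(\<integral>\<^sup>+s. ennreal (a * G b * exp (- S * lam)) * indicator ?I s \<partial>lebesgue)
        = ennreal (a * G b * exp (- S * lam) * T)"
      unfolding I using T ab by (simp add: nn_integral_cmult_indicator ennreal_mult)
    finally show "ennreal (a * G b * exp (- S * lam) * T)
        \<le> history ({0<..<snd z} \<inter> {..<T}) u (fst z) (snd z)"
      by (simp add: zx)
  qed
qed

end

section \<open>Uniqueness\<close>

theorem theorem4p2:
  fixes M :: "'a measure"
    and K :: "'a \<times> 'a \<times> real \<Rightarrow> real"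
    and g h :: "'a \<times> real \<Rightarrow> real"
    and G :: "real \<Rightarrow> real"
    and lambda_minus lambda_plus \<alpha> \<beta> \<beta>\<^sub>0 \<gamma> T\<^sub>0 :: real
  assumes K_measurable: "K \<in> borel_measurable (product_measure M (product_measure M Rplus))"
    and K_nonneg: "\<And>x y t. x \<in> space M \<Longrightarrow> y \<in> space M \<Longrightarrow> 0 < t \<Longrightarrow> 0 \<le> K (x, y, t)"
    and lambda: "0 < lambda_minus" "lambda_minus \<le> lambda_plus"
    and K_bounds: "AE (x, t) in product_measure M Rplus.
        ennreal (exp (- t * lambda_plus)) \<le> (\<integral>\<^sup>+y. ennreal (K (x, y, t)) \<partial>M) \<and>
        (\<integral>\<^sup>+y. ennreal (K (x, y, t)) \<partial>M) \<le> ennreal (exp (- t * lambda_minus))"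
    and g_nonneg: "\<And>x t. x \<in> space M \<Longrightarrow> 0 < t \<Longrightarrow> 0 \<le> g (x, t)"
    and g_Linf: "g \<in> Linf (product_measure M Rplus)"
    and \<beta>: "\<beta> = enn2real (Linf_norm (product_measure M Rplus) g)"
    and T\<^sub>0: "0 < T\<^sub>0"
    and \<beta>\<^sub>0: "(INF p \<in> space M \<times> {0<..<T\<^sub>0}. g p) = \<beta>\<^sub>0" "0 < \<beta>\<^sub>0"
    and h_nonneg: "\<And>x t. x \<in> space M \<Longrightarrow> 0 < t \<Longrightarrow> 0 \<le> h (x, t)"
    and h_Linf: "h \<in> Linf (product_measure M Rplus)"
    and \<alpha>: "\<alpha> = (INF p \<in> space M \<times> {0<..}. h p)" "0 < \<alpha>"
    and \<gamma>: "\<gamma> = enn2real (Linf_norm (product_measure M Rplus) h)"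
    and G_maps: "G \<in> {0..} \<rightarrow> {0..}"
    and G_continuous: "continuous_on {0..} G"
    and G_strict_mono: "strict_mono_on {0..} G"
    and G_concave: "concave_on {0..} G"
    and G_0: "G 0 = 0"
    and eta: "\<exists>\<eta>>0. \<gamma> * G \<eta> = (\<eta> - \<beta>) * lambda_minus"
    and u\<^sub>1: "nonneg_Linf_solution M K g h G u\<^sub>1"
    and u\<^sub>2: "nonneg_Linf_solution M K g h G u\<^sub>2"
  shows "AE p in product_measure M Rplus. u\<^sub>1 p = u\<^sub>2 p"
proof -
  interpret concave_volterra M K g h G
  proof
    show "G r \<le> G s" if "0 \<le> r" "r \<le> s" for r s
      using strict_mono_on_imp_mono_on[OF G_strict_mono] that
      by (simp add: mono_onD[where A = "{0..}" and f = G])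
  qed (use K_nonneg h_nonneg G_0 G_concave in auto)
  have g_lower: "\<beta>\<^sub>0 \<le> g z" if "fst z \<in> space M" "0 < snd z" "snd z < T\<^sub>0" for z
    unfolding \<beta>\<^sub>0(1)[symmetric]
    by (rule cINF_lower) (use that g_nonneg in \<open>auto intro!: bdd_belowI2[of _ 0] simp: mem_Times_iff\<close>)
  have h_lower: "\<alpha> \<le> h (y, s)" if "y \<in> space M" "0 < s" for y s
    unfolding \<alpha>(1)
    by (rule cINF_lower) (use that h_nonneg in \<open>auto intro!: bdd_belowI2[of _ 0]\<close>)
  have G_\<beta>\<^sub>0: "0 < G \<beta>\<^sub>0"
    using strict_mono_onD[OF G_strict_mono, of 0 \<beta>\<^sub>0] \<beta>\<^sub>0(2) G_0 by simp

  have early: "AE z in XT. snd z < T\<^sub>0 \<longrightarrow> v z \<le> u z"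
    if u: "nonneg_Linf_solution M K g h G u" and v: "nonneg_Linf_solution M K g h G v" for u v
  proof (rule comparison[OF u v \<beta>\<^sub>0(2), of 0])
    show "AE z in XT. snd z < 0 \<longrightarrow> u z = v z"
      using AE_XT_space by eventually_elim auto
    show "AE z in XT. 0 \<le> snd z \<and> snd z < T\<^sub>0 \<longrightarrow>
        ennreal \<beta>\<^sub>0 \<le> ennreal (g z) + history ({0<..<snd z} \<inter> {..<0}) v (fst z) (snd z)"
      using AE_XT_space
      by eventually_elim (auto intro!: add_increasing2 ennreal_leI g_lower)
  qed

  have lower: "AE z in XT. snd z < T\<^sub>0 \<longrightarrow> \<beta>\<^sub>0 \<le> u z"
    if u: "nonneg_Linf_solution M K g h G u" for u
    using solution_AE[OF u] AE_XT_space
  proof (eventually_elim, intro impI)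
    fix z assume *: "0 \<le> u z" "ennreal (u z) = ennreal (g z) + history {0<..<snd z} u (fst z) (snd z)"
      "fst z \<in> space M \<and> 0 < snd z" "snd z < T\<^sub>0"
    then have "ennreal (g z) \<le> ennreal (u z)" by simp
    then have "g z \<le> u z" using *(1) by simp
    then show "\<beta>\<^sub>0 \<le> u z" using g_lower[of z] * by simp
  qed

  have K_lower: "AE z in XT. ennreal (exp (- snd z * lambda_plus))
      \<le> (\<integral>\<^sup>+y. ennreal (K (fst z, y, snd z)) \<partial>M)"
    using K_bounds by eventually_elim auto
  have late: "AE z in XT. snd z < S \<longrightarrow> v z \<le> u z"
    if u: "nonneg_Linf_solution M K g h G u" and v: "nonneg_Linf_solution M K g h G v" for u v S
  proof (rule comparison[OF u v])
    show "0 < \<alpha> * G \<beta>\<^sub>0 * exp (- S * lambda_plus) * T\<^sub>0"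
      using \<alpha>(2) G_\<beta>\<^sub>0 T\<^sub>0 by simp
    show "AE z in XT. snd z < T\<^sub>0 \<longrightarrow> u z = v z"
      using early[OF u v] early[OF v u] by eventually_elim auto
    show "AE z in XT. T\<^sub>0 \<le> snd z \<and> snd z < S \<longrightarrow>
        ennreal (\<alpha> * G \<beta>\<^sub>0 * exp (- S * lambda_plus) * T\<^sub>0)
          \<le> ennreal (g z) + history ({0<..<snd z} \<inter> {..<T\<^sub>0}) v (fst z) (snd z)"
      using history_lower_bound[OF _ h_lower _ lower[OF v] T\<^sub>0 _ K_lower, of S] \<alpha>(2) \<beta>\<^sub>0(2) lambda
      by (auto elim!: eventually_mono intro: add_increasing)
  qed

  have "AE z in XT. \<forall>n. snd z < real n \<longrightarrow> u\<^sub>1 z = u\<^sub>2 z"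
    unfolding AE_all_countable
  proof
    show "AE z in XT. snd z < real n \<longrightarrow> u\<^sub>1 z = u\<^sub>2 z" for n
      using late[OF u\<^sub>1 u\<^sub>2, of n] late[OF u\<^sub>2 u\<^sub>1, of n] by eventually_elim auto
  qed
  then show ?thesis
    \<comment> \<open>Every time lies below some natural number.\<close>
    by eventually_elim (use reals_Archimedean2 in blast)
qed

end
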